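(* Let $p$ be a prime, let $G$ be a cyclic group of order $p$, let $m\ge 1$ and $2\le k\le p$ be integers, and let $X$ be a paracompact free $G$-space. Assume that $\mathrm{g}_{\rm free}(X)>(m-1)(p-1)+k-1$. Then for any continuous map $f:X\to\mathbb R^m$ $$\mathrm{g}_{\rm free}(A(f,k))\ge \mathrm{g}_{\rm free}(X)-(m-1)(p-1)-k+1.$$
   Context: A $G$-space is a topological space with a continuous left action of the finite group $G$. For a $G$-space $X$ and a continuous map $f:X\to Y$, the coincidence set is $$A(f,k)=\{x\in X:\ \exists\text{ distinct } g_1,\dots,g_k\in G\text{ such that } f(g_1x)=f(g_2x)=\dots=f(g_kx)\},$$ a $G$-invariant subspace of $X$. The free genus $\mathrm{g}_{\rm free}(X)$ of a free $G$-space $X$ is the least $n\ge 0$ such that $X$ can be covered by $n$ ($G$-invariant) open subsets $X_1,\dots,X_n$ such that for every $i$ there exists a $G$-equivariant continuous map $X_i\to G$ ($G$ discrete, acting on itself by left multiplication). It is $\infty$ if there is no such $n$, and the empty space has genus $0$. *)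

theory Defs
  imports "HOL-Analysis.Analysis" "HOL-Algebra.Elementary_Groups" "HOL-Algebra.Group_Action" "HOL-Library.Extended_Nat"
begin

text \<open>
  The carrier of an abstract topology with a left action of a group \<open>G\<close>; the action
  is given by \<open>\<phi> g x = g x\<close>. All uses have \<open>G\<close> finite (and discrete), so continuity of
  \<open>G \<times> X \<rightarrow> X\<close> amounts to continuity of every translation.
\<close>

definition G_space ::
    "('g, 'b) monoid_scheme \<Rightarrow> 'x topology \<Rightarrow> ('g \<Rightarrow> 'x \<Rightarrow> 'x) \<Rightarrow> bool" where
  "G_space G X \<phi> \<longleftrightarrow>
     group_action G (topspace X) \<phi> \<and> (\<forall>g \<in> carrier G. continuous_map X X (\<phi> g))"

definition free_G_space ::
    "('g, 'b) monoid_scheme \<Rightarrow> 'x topology \<Rightarrow> ('g \<Rightarrow> 'x \<Rightarrow> 'x) \<Rightarrow> bool" where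
  "free_G_space G X \<phi> \<longleftrightarrow>
     G_space G X \<phi> \<and>
     (\<forall>g \<in> carrier G. \<forall>x \<in> topspace X. \<phi> g x = x \<longrightarrow> g = \<one>\<^bsub>G\<^esub>)"

text \<open>As usual, a paracompact space is by convention Hausdorff.\<close>

definition paracompact_space :: "'x topology \<Rightarrow> bool" where
  "paracompact_space X \<longleftrightarrow>
     Hausdorff_space X \<and>
     (\<forall>\<U>. (\<forall>U \<in> \<U>. openin X U) \<and> \<Union>\<U> = topspace X \<longrightarrow>
        (\<exists>\<V>. (\<forall>V \<in> \<V>. openin X V) \<and> \<Union>\<V> = topspace X \<and>
             (\<forall>V \<in> \<V>. \<exists>U \<in> \<U>. V \<subseteq> U) \<and> locally_finite_in X \<V>))"

definition G_invariant ::
    "('g, 'b) monoid_scheme \<Rightarrow> ('g \<Rightarrow> 'x \<Rightarrow> 'x) \<Rightarrow> 'x set \<Rightarrow> bool" where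
  "G_invariant G \<phi> A \<longleftrightarrow> (\<forall>g \<in> carrier G. \<forall>x \<in> A. \<phi> g x \<in> A)"

text \<open>
  Only the values of \<open>\<phi>\<close> at points of \<open>X\<close> matter here, so that the genus of an invariant
  subspace \<open>A\<close> is \<open>free_genus G (subtopology X A) \<phi>\<close>, without restricting \<open>\<phi>\<close>.
  If no finite cover of the required form exists, the infimum of the empty set is \<open>\<infinity>\<close>.
\<close>

definition free_genus ::
    "('g, 'b) monoid_scheme \<Rightarrow> 'x topology \<Rightarrow> ('g \<Rightarrow> 'x \<Rightarrow> 'x) \<Rightarrow> enat" where
  "free_genus G X \<phi> =
     Inf {enat n | n. \<exists>U :: nat \<Rightarrow> 'x set.
       (\<Union>i<n. U i) = topspace X \<and>
       (\<forall>i<n. openin X (U i) \<and> G_invariant G \<phi> (U i) \<and>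
          (\<exists>h. continuous_map (subtopology X (U i)) (discrete_topology (carrier G)) h \<and>
               (\<forall>g \<in> carrier G. \<forall>x \<in> U i. h (\<phi> g x) = g \<otimes>\<^bsub>G\<^esub> h x)))}"

definition coincidence_set ::
    "('g, 'b) monoid_scheme \<Rightarrow> 'x topology \<Rightarrow> ('g \<Rightarrow> 'x \<Rightarrow> 'x) \<Rightarrow> ('x \<Rightarrow> 'y) \<Rightarrow> nat \<Rightarrow> 'x set" where
  "coincidence_set G X \<phi> f k =
     {x \<in> topspace X. \<exists>\<gamma> :: nat \<Rightarrow> 'g. \<gamma> \<in> {1..k} \<rightarrow> carrier G \<and> inj_on \<gamma> {1..k} \<and>
        (\<forall>i \<in> {1..k}. \<forall>j \<in> {1..k}. f (\<phi> (\<gamma> i) x) = f (\<phi> (\<gamma> j) x))}"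

lemma free_genus_empty:
  assumes "topspace X = {}"
  shows "free_genus G X \<phi> = 0"
proof -
  have "free_genus G X \<phi> \<le> enat 0"
    unfolding free_genus_def by (rule Inf_lower) (simp add: assms)
  then show ?thesis
    by (simp add: zero_enat_def [symmetric])
qed

lemma G_invariant_coincidence_set:
  assumes "G_space G X \<phi>"
  shows "G_invariant G \<phi> (coincidence_set G X \<phi> f k)"
  unfolding G_invariant_def
proof (intro ballI)
  fix g x
  assume g: "g \<in> carrier G" and "x \<in> coincidence_set G X \<phi> f k"
  then obtain \<gamma> where x: "x \<in> topspace X" and \<gamma>: "\<gamma> \<in> {1..k} \<rightarrow> carrier G" "inj_on \<gamma> {1..k}"
    and eq: "\<forall>i \<in> {1..k}. \<forall>j \<in> {1..k}. f (\<phi> (\<gamma> i) x) = f (\<phi> (\<gamma> j) x)"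
    unfolding coincidence_set_def by blast
  interpret group_action G "topspace X" \<phi>
    using assms by (simp add: G_space_def)
  interpret group G
    using group_hom group_hom.axioms(1) by blast
  let ?\<delta> = "\<lambda>i. \<gamma> i \<otimes>\<^bsub>G\<^esub> inv\<^bsub>G\<^esub> g"
  have gx: "\<phi> g x \<in> topspace X"
    using g x element_image by blast
  have act: "\<phi> (?\<delta> i) (\<phi> g x) = \<phi> (\<gamma> i) x" if "i \<in> {1..k}" for i
  proof -
    have "\<gamma> i \<in> carrier G" using \<gamma>(1) that by blast
    then show ?thesis
      using g x composition_rule [of x "?\<delta> i" g] by (simp add: m_assoc)
  qed
  have "?\<delta> \<in> {1..k} \<rightarrow> carrier G"
    using \<gamma>(1) g by auto
  moreover have "inj_on ?\<delta> {1..k}"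
  proof (rule inj_onI)
    fix i j
    assume ij: "i \<in> {1..k}" "j \<in> {1..k}"
      and "?\<delta> i = ?\<delta> j"
    moreover have "\<gamma> i \<in> carrier G" "\<gamma> j \<in> carrier G"
      using \<gamma>(1) ij by blast+
    ultimately have "\<gamma> i = \<gamma> j"
      using g by simp
    with \<gamma>(2) ij show "i = j"
      by (simp add: inj_on_eq_iff)
  qed
  moreover have "\<forall>i \<in> {1..k}. \<forall>j \<in> {1..k}. f (\<phi> (?\<delta> i) (\<phi> g x)) = f (\<phi> (?\<delta> j) (\<phi> g x))"
    using eq act by metis
  ultimately show "\<phi> g x \<in> coincidence_set G X \<phi> f k"
    unfolding coincidence_set_def using gx by blast
qed

end

theory Submission
  imports Defs "HOL-Algebra.Multiplicative_Group" "HOL-Number_Theory.Cong"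
begin

text \<open>
  Write \<open>A\<close> for the coincidence set. It is closed and invariant, and the theorem follows from the
  subadditivity
  \<open>genus X \<le> genus A + N\<close> with \<open>N = (m - 1)(p - 1) + (k - 1)\<close>, where \<open>N\<close> is the number of open
  invariant sets with an equivariant map to \<open>G\<close> (called tubes below) that suffice to cover the
  complement of \<open>A\<close>.

  The \<open>N\<close> tubes come from order comparisons on orbits. Fix a coordinate \<open>c\<close> of \<open>f\<close> and a size \<open>j\<close>
  with \<open>0 < j < p\<close>. The points \<open>x\<close> for which some \<open>S \<subseteq> G\<close> of size \<open>j\<close> satisfies
  \<open>f(sx)\<^sub>c > f(tx)\<^sub>c\<close> for all \<open>s \<in> S\<close>, \<open>t \<notin> S\<close> form an open invariant set (\<open>top_set\<close>). The set \<open>S\<close>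
  is determined by \<open>x\<close> and \<open>j\<close>, is locally constant in \<open>x\<close>, and is translated when \<open>x\<close> is moved by
  \<open>G\<close>. Since \<open>j\<close> is prime to \<open>p\<close>, there is an equivariant choice of a group element for each set of
  size \<open>j\<close> (\<open>equivariant_selection\<close>), so this open set is a tube (\<open>tube_top_set\<close>).

  Now fix one coordinate \<open>c\<^sub>0\<close>. If some coordinate \<open>c \<noteq> c\<^sub>0\<close> of \<open>f\<close> is not constant on the orbit of
  \<open>x\<close>, then the set where it is maximal has some size \<open>j \<in> {1..<p}\<close>; this accounts for
  \<open>(m - 1)(p - 1)\<close> tubes. Otherwise \<open>f\<close> takes a single value on the set where coordinate \<open>c\<^sub>0\<close> is
  maximal, so outside \<open>A\<close> that set has some size \<open>j \<in> {1..<k}\<close>; this accounts for \<open>k - 1\<close> tubes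
  (\<open>complement_coincidence_set_cover\<close>).

  For the subadditivity (\<open>free_genus_le_closed_add_card\<close>), tubes of the closed subspace \<open>A\<close> have to be
  replaced by equally many tubes of \<open>X\<close> that cover \<open>A\<close>. This rests on the normality of paracompact
  spaces and is done by peeling off one closed piece of \<open>A\<close> at a time (\<open>extend_tubes\<close>).
\<close>

section \<open>Paracompact spaces are normal\<close>

text \<open>
  Separation of the points of \<open>A\<close> from \<open>B\<close> can be made uniform: in a locally finite family of open
  sets that covers \<open>A\<close> and whose closures avoid \<open>B\<close>, the closure of the union is the union of the
  closures. The lemma passes from points to closed sets, and using it twice turns the Hausdorff
  property into regularity and then into normality.
\<close>

lemma paracompact_separation:
  assumes X: "paracompact_space X"
    and A: "closedin X A" and B: "B \<subseteq> topspace X"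
    and sep: "\<And>a. a \<in> A \<Longrightarrow> \<exists>U V. openin X U \<and> openin X V \<and> a \<in> U \<and> B \<subseteq> V \<and> disjnt U V"
  shows "\<exists>U V. openin X U \<and> openin X V \<and> A \<subseteq> U \<and> B \<subseteq> V \<and> disjnt U V"
proof -
  define \<U> where "\<U> = {U. openin X U \<and> (\<exists>V. openin X V \<and> B \<subseteq> V \<and> disjnt U V)} \<union> {topspace X - A}"
  have "\<forall>U\<in>\<U>. openin X U"
    using A by (auto simp: \<U>_def)
  moreover have "\<Union>\<U> = topspace X"
  proof
    show "\<Union>\<U> \<subseteq> topspace X"
      using openin_subset by (fastforce simp: \<U>_def)
    show "topspace X \<subseteq> \<Union>\<U>"
    proof
      fix x
      assume x: "x \<in> topspace X"
      show "x \<in> \<Union>\<U>"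
      proof (cases "x \<in> A")
        case True
        then obtain U V where "openin X U \<and> openin X V \<and> x \<in> U \<and> B \<subseteq> V \<and> disjnt U V"
          using sep by meson
        then show ?thesis
          unfolding \<U>_def by blast
      qed (use x in \<open>auto simp: \<U>_def\<close>)
    qed
  qed
  ultimately obtain \<V> where \<V>: "\<forall>V\<in>\<V>. openin X V" "\<Union>\<V> = topspace X"
      "\<forall>V\<in>\<V>. \<exists>U\<in>\<U>. V \<subseteq> U" "locally_finite_in X \<V>"
    using X[unfolded paracompact_space_def, THEN conjunct2, rule_format, of \<U>] by auto
  \<comment> \<open>Members that meet \<open>A\<close> are not contained in the complement of \<open>A\<close>, hence refine the sets
     separated from \<open>B\<close>.\<close>
  define \<W> where "\<W> = {V \<in> \<V>. V \<inter> A \<noteq> {}}"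
  have lf: "locally_finite_in X \<W>"
    using \<V>(4) by (rule locally_finite_in_subset) (auto simp: \<W>_def)
  have "X closure_of V \<inter> B = {}" if "V \<in> \<W>" for V
  proof -
    obtain U where U: "U \<in> \<U>" "V \<subseteq> U"
      using \<open>V \<in> \<W>\<close> \<V>(3) by (auto simp: \<W>_def)
    have "U \<noteq> topspace X - A"
      using that U by (auto simp: \<W>_def)
    then obtain T where T: "openin X T" "B \<subseteq> T" "disjnt U T"
      using U by (auto simp: \<U>_def)
    have "T \<inter> X closure_of V = {}"
      using T U openin_Int_closure_of_eq_empty[of X T V] by (auto simp: disjnt_def)
    then show ?thesis
      using T by blast
  qed
  then have clB: "X closure_of (\<Union>\<W>) \<inter> B = {}"
    by (auto simp: closure_of_locally_finite_Union[OF lf])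
  have op: "openin X (\<Union>\<W>)"
    using \<V> by (auto simp: \<W>_def)
  show ?thesis
  proof (intro exI conjI)
    show "openin X (\<Union>\<W>)" by fact
    show "openin X (topspace X - X closure_of (\<Union>\<W>))"
      by (simp add: openin_diff)
    show "A \<subseteq> \<Union>\<W>"
      using \<V>(2) closedin_subset[OF A] unfolding \<W>_def by blast
    show "B \<subseteq> topspace X - X closure_of (\<Union>\<W>)"
      using B clB by blast
    show "disjnt (\<Union>\<W>) (topspace X - X closure_of (\<Union>\<W>))"
      using closure_of_subset[OF openin_subset[OF op]] unfolding disjnt_def by blast
  qed
qed

lemma paracompact_imp_normal_space:
  assumes X: "paracompact_space X"
  shows "normal_space X"
  unfolding normal_space_def
proof (intro allI impI, elim conjE)
  fix S T
  assume S: "closedin X S" and T: "closedin X T" and "disjnt S T"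
  have point: "\<exists>U V. openin X U \<and> openin X V \<and> S \<subseteq> U \<and> {b} \<subseteq> V \<and> disjnt U V"
    if b: "b \<in> topspace X" "b \<notin> S" for b
  proof (rule paracompact_separation[OF X S])
    show "{b} \<subseteq> topspace X"
      using b by simp
    fix a
    assume "a \<in> S"
    moreover have "a \<in> topspace X"
      using \<open>a \<in> S\<close> closedin_subset[OF S] by blast
    moreover have "Hausdorff_space X"
      using X by (simp add: paracompact_space_def)
    ultimately show "\<exists>U V. openin X U \<and> openin X V \<and> a \<in> U \<and> {b} \<subseteq> V \<and> disjnt U V"
      using b unfolding Hausdorff_space_def by (metis empty_subsetI insert_subset)
  qed
  have "\<exists>U V. openin X U \<and> openin X V \<and> T \<subseteq> U \<and> S \<subseteq> V \<and> disjnt U V"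
  proof (rule paracompact_separation[OF X T closedin_subset[OF S]])
    fix b
    assume "b \<in> T"
    then have "b \<in> topspace X" "b \<notin> S"
      using \<open>disjnt S T\<close> closedin_subset[OF T] by (auto simp: disjnt_def)
    from point[OF this]
    show "\<exists>U V. openin X U \<and> openin X V \<and> b \<in> U \<and> S \<subseteq> V \<and> disjnt U V"
      by (metis disjnt_sym insert_subset)
  qed
  then show "\<exists>U V. openin X U \<and> openin X V \<and> S \<subseteq> U \<and> T \<subseteq> V \<and> disjnt U V"
    by (metis disjnt_sym)
qed

section \<open>Tubes and the free genus\<close>

lemma G_space_facts:
  assumes "G_space G X \<phi>"
  shows G_space_group: "group G"
    and G_space_closed: "\<And>g x. g \<in> carrier G \<Longrightarrow> x \<in> topspace X \<Longrightarrow> \<phi> g x \<in> topspace X"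
    and G_space_one: "\<And>x. x \<in> topspace X \<Longrightarrow> \<phi> \<one>\<^bsub>G\<^esub> x = x"
    and G_space_comp: "\<And>g h x. g \<in> carrier G \<Longrightarrow> h \<in> carrier G \<Longrightarrow> x \<in> topspace X
          \<Longrightarrow> \<phi> g (\<phi> h x) = \<phi> (g \<otimes>\<^bsub>G\<^esub> h) x"
    and G_space_continuous: "\<And>g. g \<in> carrier G \<Longrightarrow> continuous_map X X (\<phi> g)"
proof -
  interpret group_action G "topspace X" \<phi>
    using assms by (simp add: G_space_def)
  show "group G"
    using group_hom group_hom.axioms(1) by blast
  show "\<And>g x. g \<in> carrier G \<Longrightarrow> x \<in> topspace X \<Longrightarrow> \<phi> g x \<in> topspace X"
    using element_image by blast
  show "\<And>x. x \<in> topspace X \<Longrightarrow> \<phi> \<one>\<^bsub>G\<^esub> x = x"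
    using id_eq_one by (metis restrict_apply')
  show "\<And>g h x. g \<in> carrier G \<Longrightarrow> h \<in> carrier G \<Longrightarrow> x \<in> topspace X
          \<Longrightarrow> \<phi> g (\<phi> h x) = \<phi> (g \<otimes>\<^bsub>G\<^esub> h) x"
    using composition_rule by metis
  show "\<And>g. g \<in> carrier G \<Longrightarrow> continuous_map X X (\<phi> g)"
    using assms by (simp add: G_space_def)
qed

text \<open>
  A tube is a single member of a cover counted by the free genus. Continuity of the map to the
  discrete group is expressed by the openness of its fibres, the form in which it is
  constructed and used.
\<close>

definition tube ::
    "('g, 'b) monoid_scheme \<Rightarrow> 'x topology \<Rightarrow> ('g \<Rightarrow> 'x \<Rightarrow> 'x) \<Rightarrow> 'x set \<Rightarrow> bool" where
  "tube G X \<phi> U \<longleftrightarrow> openin X U \<and> G_invariant G \<phi> U \<and>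
     (\<exists>h. h \<in> U \<rightarrow> carrier G \<and> (\<forall>c \<in> carrier G. openin X {x \<in> U. h x = c}) \<and>
          (\<forall>g \<in> carrier G. \<forall>x \<in> U. h (\<phi> g x) = g \<otimes>\<^bsub>G\<^esub> h x))"

lemma continuous_map_into_discrete:
  "continuous_map X (discrete_topology C) h \<longleftrightarrow>
     h \<in> topspace X \<rightarrow> C \<and> (\<forall>c \<in> C. openin X {x \<in> topspace X. h x = c})"
proof (intro iffI conjI ballI)
  assume h: "continuous_map X (discrete_topology C) h"
  then show "h \<in> topspace X \<rightarrow> C"
    using continuous_map_image_subset_topspace by fastforce
  fix c
  assume "c \<in> C"
  then show "openin X {x \<in> topspace X. h x = c}"
    using openin_continuous_map_preimage[OF h, of "{c}"] by simp
next
  assume h: "h \<in> topspace X \<rightarrow> C \<and> (\<forall>c \<in> C. openin X {x \<in> topspace X. h x = c})"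
  have "openin X {x \<in> topspace X. h x \<in> U}" if "U \<subseteq> C" for U
  proof -
    have "{x \<in> topspace X. h x \<in> U} = (\<Union>c\<in>U. {x \<in> topspace X. h x = c})"
      by auto
    then show ?thesis
      using h that by (simp only:) (intro openin_Union, blast)
  qed
  then show "continuous_map X (discrete_topology C) h"
    using h by (auto simp: continuous_map_def)
qed

lemma tube_iff:
  "tube G X \<phi> U \<longleftrightarrow> openin X U \<and> G_invariant G \<phi> U \<and>
     (\<exists>h. continuous_map (subtopology X U) (discrete_topology (carrier G)) h \<and>
          (\<forall>g \<in> carrier G. \<forall>x \<in> U. h (\<phi> g x) = g \<otimes>\<^bsub>G\<^esub> h x))"
proof -
  have "continuous_map (subtopology X U) (discrete_topology (carrier G)) h \<longleftrightarrow>
      h \<in> U \<rightarrow> carrier G \<and> (\<forall>c \<in> carrier G. openin X {x \<in> U. h x = c})"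
    if U: "openin X U" for h
  proof -
    have "topspace (subtopology X U) = U"
      using openin_subset[OF U] by auto
    then show ?thesis
      using U by (auto simp: continuous_map_into_discrete openin_open_subtopology)
  qed
  then show ?thesis
    unfolding tube_def by blast
qed

text \<open>
  Arbitrary finite index sets let covers be assembled from pairs (coordinate, size) and from
  disjoint sums without an explicit enumeration.
\<close>

lemma free_genus_le_card:
  assumes "finite I" and "(\<Union>i\<in>I. U i) = topspace X" and "\<And>i. i \<in> I \<Longrightarrow> tube G X \<phi> (U i)"
  shows "free_genus G X \<phi> \<le> enat (card I)"
proof -
  obtain e where e: "bij_betw e {0..<card I} I"
    using ex_bij_betw_nat_finite[OF \<open>finite I\<close>] by blast
  then have eI: "e ` {..<card I} = I"
    by (simp add: bij_betw_def atLeast0LessThan)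
  show ?thesis
    unfolding free_genus_def tube_iff[symmetric]
  proof (rule Inf_lower, rule CollectI, intro exI conjI)
    show "(\<Union>i<card I. U (e i)) = topspace X"
      using assms(2) eI by (metis image_image)
    show "\<forall>i<card I. tube G X \<phi> (U (e i))"
      using assms(3) eI by blast
  qed simp
qed

text \<open>A finite genus is attained, because \<open>\<nat>\<close> is well-ordered.\<close>

lemma free_genus_tubes:
  assumes "free_genus G X \<phi> = enat n"
  shows "\<exists>U. (\<Union>i<n. U i) = topspace X \<and> (\<forall>i<n. tube G X \<phi> (U i))"
proof -
  define N where "N = {enat n | n. \<exists>U.
       (\<Union>i<n. U i) = topspace X \<and> (\<forall>i<n. tube G X \<phi> (U i))}"
  have inf: "free_genus G X \<phi> = Inf N"
    by (simp add: free_genus_def tube_iff N_def)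
  have "N \<noteq> {}"
    using assms unfolding inf by (auto simp: top_enat_def)
  then have "Inf N \<in> N"
    unfolding Inf_enat_def by (auto intro: LeastI)
  then show ?thesis
    using assms unfolding inf N_def by auto
qed

lemma tube_restrict:
  assumes U: "tube G (subtopology X A) \<phi> U" and B: "B \<subseteq> A" "G_invariant G \<phi> B"
  shows "tube G (subtopology X B) \<phi> (U \<inter> B)"
proof -
  obtain h where h: "h \<in> U \<rightarrow> carrier G" "\<forall>c \<in> carrier G. openin (subtopology X A) {x \<in> U. h x = c}"
      "\<forall>g \<in> carrier G. \<forall>x \<in> U. h (\<phi> g x) = g \<otimes>\<^bsub>G\<^esub> h x"
    and U': "openin (subtopology X A) U" "G_invariant G \<phi> U"
    using U unfolding tube_def by blast
  have res: "openin (subtopology X B) (T \<inter> B)" if "openin (subtopology X A) T" for T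
    using that B(1) by (auto simp: openin_subtopology)
  have "{x \<in> U \<inter> B. h x = c} = {x \<in> U. h x = c} \<inter> B" for c
    by blast
  then have "\<forall>c \<in> carrier G. openin (subtopology X B) {x \<in> U \<inter> B. h x = c}"
    using res h(2) by metis
  moreover have "G_invariant G \<phi> (U \<inter> B)"
    using U'(2) B(2) by (auto simp: G_invariant_def)
  ultimately show ?thesis
    unfolding tube_def using h res[OF U'(1)] by blast
qed

section \<open>Extending tubes from a closed invariant subspace\<close>

text \<open>
  The fibres \<open>D\<^sub>g\<close> of the equivariant map \<open>h\<close> on \<open>C\<close> are disjoint closed sets permuted by \<open>G\<close>, with
  \<open>g D\<^sub>1 = D\<^sub>g\<close>. Normality separates \<open>D\<^sub>1\<close> from each of the finitely many other \<open>D\<^sub>g\<close>, and so gives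
  an open \<open>S\<close> around \<open>D\<^sub>1\<close> that is disjoint from all its translates \<open>g S\<close>, \<open>g \<noteq> 1\<close>. The union of the
  translates of \<open>S\<close> is the tube, and its map to \<open>G\<close> sends \<open>g S\<close> to \<open>g\<close>.
\<close>

lemma tube_around_closed:
  assumes G: "G_space G X \<phi>" and fin: "finite (carrier G)" and X: "normal_space X"
    and CX: "C \<subseteq> topspace X" and inv: "G_invariant G \<phi> C"
    and h: "h \<in> C \<rightarrow> carrier G" and cl: "\<And>c. c \<in> carrier G \<Longrightarrow> closedin X {x \<in> C. h x = c}"
    and eq: "\<And>g x. g \<in> carrier G \<Longrightarrow> x \<in> C \<Longrightarrow> h (\<phi> g x) = g \<otimes>\<^bsub>G\<^esub> h x"
  shows "\<exists>W. tube G X \<phi> W \<and> C \<subseteq> W"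
proof -
  interpret group G
    by (rule G_space_group[OF G])
  note act = G_space_closed[OF G] G_space_one[OF G] G_space_comp[OF G]
  let ?D = "\<lambda>c. {x \<in> C. h x = c}"
  define sep where "sep g U V \<longleftrightarrow> openin X U \<and> openin X V \<and> ?D \<one>\<^bsub>G\<^esub> \<subseteq> U \<and> ?D g \<subseteq> V \<and> disjnt U V"
    for g U V
  have "\<exists>U V. sep g U V"
    if "g \<in> carrier G - {\<one>\<^bsub>G\<^esub>}" for g
    using X cl[of g] cl[of "\<one>\<^bsub>G\<^esub>"] that unfolding normal_space_def sep_def by (auto simp: disjnt_def)
  then obtain U V where "\<And>g. g \<in> carrier G - {\<one>\<^bsub>G\<^esub>} \<Longrightarrow> sep g (U g) (V g)"
    by metis
  then have UV: "openin X (U g) \<and> openin X (V g) \<and> ?D \<one>\<^bsub>G\<^esub> \<subseteq> U g \<and> ?D g \<subseteq> V g \<and> disjnt (U g) (V g)"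
    if "g \<in> carrier G - {\<one>\<^bsub>G\<^esub>}" for g
    using that unfolding sep_def by blast
  define S where "S = {x \<in> topspace X. \<forall>g \<in> carrier G - {\<one>\<^bsub>G\<^esub>}. x \<in> U g \<and> \<phi> g x \<in> V g}"
  have pre: "openin X {x \<in> topspace X. \<phi> g x \<in> T}" if "g \<in> carrier G" "openin X T" for g T
    using openin_continuous_map_preimage[OF G_space_continuous[OF G] that(2)] that(1) by blast
  have "S = (\<Inter>g \<in> carrier G - {\<one>\<^bsub>G\<^esub>}. U g \<inter> {x \<in> topspace X. \<phi> g x \<in> V g}) \<inter> topspace X"
    by (auto simp: S_def)
  also have "openin X \<dots>"
    using fin UV pre by (intro openin_INT) auto
  finally have S: "openin X S" .
  have disj: "g = \<one>\<^bsub>G\<^esub>" if "g \<in> carrier G" "x \<in> S" "\<phi> g x \<in> S" for g x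
    using that UV[of g] unfolding S_def disjnt_def by blast
  have D1: "x \<in> S" if "x \<in> C" "h x = \<one>\<^bsub>G\<^esub>" for x
  proof -
    have "\<phi> g x \<in> ?D g" if "g \<in> carrier G" for g
      using inv eq that \<open>x \<in> C\<close> \<open>h x = \<one>\<^bsub>G\<^esub>\<close> by (auto simp: G_invariant_def)
    then have "x \<in> U g \<and> \<phi> g x \<in> V g" if "g \<in> carrier G - {\<one>\<^bsub>G\<^esub>}" for g
      using UV[OF that] that \<open>x \<in> C\<close> \<open>h x = \<one>\<^bsub>G\<^esub>\<close> by blast
    then show ?thesis
      using \<open>x \<in> C\<close> CX unfolding S_def by blast
  qed
  define W where "W = {x \<in> topspace X. \<exists>g \<in> carrier G. \<phi> (inv\<^bsub>G\<^esub> g) x \<in> S}"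
  define r where "r x = (THE g. g \<in> carrier G \<and> \<phi> (inv\<^bsub>G\<^esub> g) x \<in> S)" for x
  have r_eq: "r x = g" if "x \<in> topspace X" "g \<in> carrier G" "\<phi> (inv\<^bsub>G\<^esub> g) x \<in> S" for x g
    unfolding r_def
  proof (rule the_equality)
    fix g'
    assume g': "g' \<in> carrier G \<and> \<phi> (inv\<^bsub>G\<^esub> g') x \<in> S"
    then have "\<phi> (inv\<^bsub>G\<^esub> g' \<otimes>\<^bsub>G\<^esub> g) (\<phi> (inv\<^bsub>G\<^esub> g) x) \<in> S"
      using that by (simp add: act m_assoc)
    then have "inv\<^bsub>G\<^esub> g' \<otimes>\<^bsub>G\<^esub> g = \<one>\<^bsub>G\<^esub>"
      using disj[of "inv\<^bsub>G\<^esub> g' \<otimes>\<^bsub>G\<^esub> g" "\<phi> (inv\<^bsub>G\<^esub> g) x"] that g' by simp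
    then show "g' = g"
      using that g' by (metis inv_closed inv_equality inv_inv)
  qed (use that in simp)
  have level: "{x \<in> W. r x = g} = {x \<in> topspace X. \<phi> (inv\<^bsub>G\<^esub> g) x \<in> S}" if "g \<in> carrier G" for g
    using r_eq that unfolding W_def by blast
  have trans: "\<phi> (inv\<^bsub>G\<^esub> (g \<otimes>\<^bsub>G\<^esub> c)) (\<phi> g x) = \<phi> (inv\<^bsub>G\<^esub> c) x"
    if "g \<in> carrier G" "c \<in> carrier G" "x \<in> topspace X" for g c x
    using that by (simp add: act inv_mult_group m_assoc)
  have "tube G X \<phi> W"
    unfolding tube_def
  proof (intro conjI exI[of _ r] ballI)
    have "W = (\<Union>g\<in>carrier G. {x \<in> topspace X. \<phi> (inv\<^bsub>G\<^esub> g) x \<in> S})"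
      by (auto simp: W_def)
    also have "openin X \<dots>"
      using pre S by blast
    finally show "openin X W" .
    show "G_invariant G \<phi> W"
      unfolding G_invariant_def
    proof (intro ballI)
      fix g x
      assume g: "g \<in> carrier G" and "x \<in> W"
      then obtain c where c: "c \<in> carrier G" "\<phi> (inv\<^bsub>G\<^esub> c) x \<in> S" "x \<in> topspace X"
        by (auto simp: W_def)
      then have "\<phi> (inv\<^bsub>G\<^esub> (g \<otimes>\<^bsub>G\<^esub> c)) (\<phi> g x) \<in> S"
        using trans g by simp
      then show "\<phi> g x \<in> W"
        unfolding W_def using m_closed[OF g c(1)] act(1)[OF g c(3)] by blast
    qed
    show "r \<in> W \<rightarrow> carrier G"
      using r_eq by (auto simp: W_def)
    show "openin X {x \<in> W. r x = c}" if "c \<in> carrier G" for c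
      using level pre S that by simp
    show "r (\<phi> g x) = g \<otimes>\<^bsub>G\<^esub> r x" if "g \<in> carrier G" "x \<in> W" for g x
    proof -
      obtain c where c: "c \<in> carrier G" "\<phi> (inv\<^bsub>G\<^esub> c) x \<in> S" "x \<in> topspace X"
        using \<open>x \<in> W\<close> by (auto simp: W_def)
      then have "\<phi> (inv\<^bsub>G\<^esub> (g \<otimes>\<^bsub>G\<^esub> c)) (\<phi> g x) \<in> S"
        using trans that by simp
      then show ?thesis
        using r_eq c that act(1) by simp
    qed
  qed
  moreover have "C \<subseteq> W"
  proof
    fix x
    assume x: "x \<in> C"
    then have hx: "h x \<in> carrier G"
      using h by blast
    have "\<phi> (inv\<^bsub>G\<^esub> (h x)) x \<in> S"
      using x hx inv eq by (intro D1) (auto simp: G_invariant_def)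
    then show "x \<in> W"
      using x hx CX by (auto simp: W_def)
  qed
  ultimately show ?thesis
    by blast
qed

text \<open>
  The part \<open>C\<close> of \<open>A\<close> outside the first \<open>n\<close> tubes is closed in \<open>X\<close> and lies in the last one, so it
  has a neighbourhood \<open>W0\<close> that is a tube of \<open>X\<close>. What remains of \<open>A\<close> outside \<open>W0\<close> is again closed and
  invariant, and the first \<open>n\<close> tubes cover it. Removing an open set at each step is what keeps the
  pieces closed in \<open>X\<close>.
\<close>

lemma extend_tubes:
  fixes n :: nat
  assumes G: "G_space G X \<phi>" and fin: "finite (carrier G)" and X: "normal_space X"
    and "closedin X A" and "G_invariant G \<phi> A"
    and "A = (\<Union>i<n. U i)" and "\<And>i. i < n \<Longrightarrow> tube G (subtopology X A) \<phi> (U i)"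
  shows "\<exists>W. A \<subseteq> (\<Union>i<n. W i) \<and> (\<forall>i<n. tube G X \<phi> (W i))"
  using assms(4-7)
proof (induction n arbitrary: A U)
  case 0
  then show ?case by simp
next
  case (Suc n)
  interpret group G
    by (rule G_space_group[OF G])
  let ?A = "subtopology X A"
  have AX: "A \<subseteq> topspace X" and topA: "topspace ?A = A"
    using closedin_subset[OF Suc.prems(1)] by auto
  define C where "C = A - (\<Union>i<n. U i)"
  have CU: "C \<subseteq> U n"
    using Suc.prems(3) by (auto simp: C_def lessThan_Suc)
  obtain h where h: "h \<in> U n \<rightarrow> carrier G" "\<forall>c \<in> carrier G. openin ?A {x \<in> U n. h x = c}"
      "\<forall>g \<in> carrier G. \<forall>x \<in> U n. h (\<phi> g x) = g \<otimes>\<^bsub>G\<^esub> h x"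
    using Suc.prems(4)[of n] unfolding tube_def by blast
  have Uinv: "G_invariant G \<phi> (U i)" and Uop: "openin ?A (U i)" if "i < Suc n" for i
    using Suc.prems(4)[OF that] by (auto simp: tube_def)
  have invdiff: "G_invariant G \<phi> (A - T)" if T: "G_invariant G \<phi> T" for T
    unfolding G_invariant_def
  proof (intro ballI)
    fix g x
    assume g: "g \<in> carrier G" and x: "x \<in> A - T"
    have "\<phi> g x \<in> A"
      using Suc.prems(2) g x by (auto simp: G_invariant_def)
    moreover have "\<phi> g x \<notin> T"
    proof
      assume "\<phi> g x \<in> T"
      then have "\<phi> (inv\<^bsub>G\<^esub> g) (\<phi> g x) \<in> T"
        using T g unfolding G_invariant_def by (meson inv_closed)
      moreover have "\<phi> (inv\<^bsub>G\<^esub> g) (\<phi> g x) = x"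
        using g x AX G_space_comp[OF G, of "inv\<^bsub>G\<^esub> g" g x] G_space_one[OF G, of x] by auto
      ultimately show False
        using x by simp
    qed
    ultimately show "\<phi> g x \<in> A - T"
      by blast
  qed
  have Cinv: "G_invariant G \<phi> C"
    unfolding C_def
  proof (rule invdiff)
    show "G_invariant G \<phi> (\<Union>i<n. U i)"
      unfolding G_invariant_def
    proof (intro ballI)
      fix g x
      assume g: "g \<in> carrier G" and "x \<in> (\<Union>i<n. U i)"
      then obtain i where "i < n" "x \<in> U i"
        by blast
      then show "\<phi> g x \<in> (\<Union>i<n. U i)"
        using Uinv[of i] g by (auto simp: G_invariant_def)
    qed
  qed
  have cl: "closedin X {x \<in> C. h x = c}" if "c \<in> carrier G" for c
  proof -
    \<comment> \<open>Fibres of \<open>h\<close> are closed in its domain because the other fibres are open.\<close>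
    let ?O = "(\<Union>i<n. U i) \<union> (\<Union>d\<in>carrier G - {c}. {x \<in> U n. h x = d})"
    have "{x \<in> C. h x = c} = topspace ?A - ?O"
      unfolding topA
      using CU h(1) by (auto simp: C_def)
    moreover have "openin ?A ?O"
      using Uop h(2) by (intro openin_Un openin_Union) auto
    ultimately have "closedin ?A {x \<in> C. h x = c}"
      by (simp only: closedin_diff closedin_topspace)
    then show ?thesis
      using Suc.prems(1) closedin_trans_full by blast
  qed
  have "\<exists>W. tube G X \<phi> W \<and> C \<subseteq> W"
  proof (rule tube_around_closed[OF G fin X _ Cinv _ cl])
    show "C \<subseteq> topspace X"
      using AX by (auto simp: C_def)
    show "h \<in> C \<rightarrow> carrier G"
      using CU h(1) by blast
    show "h (\<phi> g x) = g \<otimes>\<^bsub>G\<^esub> h x" if "g \<in> carrier G" "x \<in> C" for g x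
      using CU h(3) that by blast
  qed
  then obtain W0 where W0: "tube G X \<phi> W0" "C \<subseteq> W0"
    by blast
  define B where "B = A - W0"
  have "openin X W0" "G_invariant G \<phi> W0"
    using W0 by (auto simp: tube_def)
  then have B: "closedin X B" "G_invariant G \<phi> B" "B \<subseteq> A"
    using Suc.prems(1) invdiff by (auto simp: B_def closedin_diff)
  have "\<exists>W. B \<subseteq> (\<Union>i<n. W i) \<and> (\<forall>i<n. tube G X \<phi> (W i))"
  proof (rule Suc.IH[OF B(1,2), of "\<lambda>i. U i \<inter> B"])
    show "B = (\<Union>i<n. U i \<inter> B)"
      using W0(2) by (auto simp: B_def C_def)
    show "\<And>i. i < n \<Longrightarrow> tube G (subtopology X B) \<phi> (U i \<inter> B)"
      using tube_restrict[OF Suc.prems(4) B(3,2)] by simp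
  qed
  then obtain W where W: "B \<subseteq> (\<Union>i<n. W i)" "\<forall>i<n. tube G X \<phi> (W i)"
    by blast
  have "A \<subseteq> (\<Union>i<Suc n. (W(n := W0)) i)"
    using W(1) by (auto simp: B_def lessThan_Suc)
  moreover have "\<forall>i<Suc n. tube G X \<phi> ((W(n := W0)) i)"
    using W(2) W0(1) by (auto simp: less_Suc_eq)
  ultimately show ?case
    by blast
qed

lemma free_genus_le_closed_add_card:
  assumes G: "G_space G X \<phi>" and fin: "finite (carrier G)" and X: "normal_space X"
    and A: "closedin X A" "G_invariant G \<phi> A"
    and I: "finite I" "\<And>i. i \<in> I \<Longrightarrow> tube G X \<phi> (V i)" "topspace X - A \<subseteq> (\<Union>i\<in>I. V i)"
  shows "free_genus G X \<phi> \<le> free_genus G (subtopology X A) \<phi> + enat (card I)"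
proof (cases "free_genus G (subtopology X A) \<phi>")
  case (enat n)
  then obtain U where U: "(\<Union>i<n. U i) = topspace (subtopology X A)"
      "\<And>i. i < n \<Longrightarrow> tube G (subtopology X A) \<phi> (U i)"
    using free_genus_tubes[OF enat] by blast
  have "topspace (subtopology X A) = A"
    using closedin_subset[OF A(1)] by auto
  then have "\<exists>W. A \<subseteq> (\<Union>i<n. W i) \<and> (\<forall>i<n. tube G X \<phi> (W i))"
    using U by (intro extend_tubes[OF G fin X A]) auto
  then obtain W where W: "A \<subseteq> (\<Union>i<n. W i)" "\<forall>i<n. tube G X \<phi> (W i)"
    by blast
  have "free_genus G X \<phi> \<le> enat (card ({..<n} <+> I))"
  proof (rule free_genus_le_card)
    show tubes: "tube G X \<phi> (case_sum W V i)" if "i \<in> {..<n} <+> I" for i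
      using that W(2) I(2) by auto
    show "(\<Union>i\<in>{..<n} <+> I. case_sum W V i) = topspace X"
    proof
      show "(\<Union>i\<in>{..<n} <+> I. case_sum W V i) \<subseteq> topspace X"
      proof (rule UN_least)
        fix i
        assume "i \<in> {..<n} <+> I"
        then show "case_sum W V i \<subseteq> topspace X"
          using tubes[of i] openin_subset[of X "case_sum W V i"] by (simp add: tube_def)
      qed
      show "topspace X \<subseteq> (\<Union>i\<in>{..<n} <+> I. case_sum W V i)"
      proof
        fix x
        assume "x \<in> topspace X"
        then consider i where "i < n" "x \<in> W i" | i where "i \<in> I" "x \<in> V i"
          using W(1) I(3) by blast
        then show "x \<in> (\<Union>i\<in>{..<n} <+> I. case_sum W V i)"
        proof cases
          case 1
          then show ?thesis
            by (intro UN_I[of "Inl i"]) auto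
        next
          case 2
          then show ?thesis
            by (intro UN_I[of "Inr i"]) auto
        qed
      qed
    qed
  qed (use I in simp)
  then show ?thesis
    using enat I(1) by (simp add: card_Plus)
qed simp

section \<open>Tubes from the maxima of a real function on an orbit\<close>

text \<open>
  The product \<open>P\<close> of the elements of a set \<open>S\<close> of size \<open>j\<close> becomes \<open>P g\<^sup>-\<^sup>j\<close> when \<open>S\<close> is translated by
  \<open>g\<^sup>-\<^sup>1\<close>. If \<open>u\<close> inverts \<open>j\<close> modulo the order of the group, then \<open>P\<^sup>-\<^sup>u\<close> is therefore multiplied by
  \<open>g\<close>.
\<close>

lemma (in comm_group) equivariant_selection:
  assumes fin: "finite (carrier G)" and cop: "coprime j (order G)"
  obtains \<tau> where "\<And>S. S \<subseteq> carrier G \<Longrightarrow> card S = j \<Longrightarrow> \<tau> S \<in> carrier G"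
    and "\<And>S g. S \<subseteq> carrier G \<Longrightarrow> card S = j \<Longrightarrow> g \<in> carrier G \<Longrightarrow>
           \<tau> ((\<lambda>s. s \<otimes> inv g) ` S) = g \<otimes> \<tau> S"
proof -
  obtain u where u: "[j * u = Suc 0] (mod order G)"
    using cong_solve_coprime_nat[OF cop] by blast
  have pow: "g [^] (j * u) = g" if g: "g \<in> carrier G" for g
  proof -
    obtain k l where "Suc 0 + k * order G = j * u + l * order G"
      using u unfolding cong_iff_lin_nat by metis
    then have "g [^] (Suc 0 + order G * k) = g [^] (j * u + order G * l)"
      by (simp add: mult.commute)
    moreover have "g [^] order G = \<one>"
      using pow_order_eq_1[OF g] .
    ultimately show ?thesis
      using g by (simp add: nat_pow_mult[symmetric] nat_pow_pow[symmetric])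
  qed
  define \<tau> where "\<tau> S = inv ((\<Otimes>s\<in>S. s) [^] u)" for S
  have cl: "(\<Otimes>s\<in>S. s) \<in> carrier G" if "S \<subseteq> carrier G" for S
    using that by (intro finprod_closed) auto
  show thesis
  proof (rule that[of \<tau>])
    show "\<tau> S \<in> carrier G" if "S \<subseteq> carrier G" for S
      using cl[OF that] by (simp add: \<tau>_def)
    show "\<tau> ((\<lambda>s. s \<otimes> inv g) ` S) = g \<otimes> \<tau> S"
      if S: "S \<subseteq> carrier G" "card S = j" and g: "g \<in> carrier G" for S g
    proof -
      have "inj_on (\<lambda>s. s \<otimes> inv g) S"
        using S g by (intro inj_onI) (metis inv_closed right_cancel subsetD)
      then have "(\<Otimes>s\<in>(\<lambda>s. s \<otimes> inv g) ` S. s) = (\<Otimes>s\<in>S. s \<otimes> inv g)"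
        using S g by (subst finprod_reindex) auto
      also have "\<dots> = (\<Otimes>s\<in>S. s) \<otimes> inv g [^] j"
        using S g by (subst finprod_multf) (auto simp: finprod_const)
      finally have "(\<Otimes>s\<in>(\<lambda>s. s \<otimes> inv g) ` S. s) [^] u = (\<Otimes>s\<in>S. s) [^] u \<otimes> inv g"
        using S g cl[OF S(1)] pow[of "inv g"] by (simp add: nat_pow_distrib nat_pow_pow)
      then show ?thesis
        using g cl[OF S(1)] by (simp add: \<tau>_def inv_mult_group)
    qed
  qed
qed

text \<open>
  The set of maxima of \<open>u\<close> on the orbit is one such \<open>S\<close>. In contrast to \<open>S\<close> being that set, this
  condition consists of finitely many strict inequalities and is therefore open in \<open>x\<close>.
\<close>

definition dominates ::
    "('g, 'b) monoid_scheme \<Rightarrow> ('g \<Rightarrow> 'x \<Rightarrow> 'x) \<Rightarrow> ('x \<Rightarrow> real) \<Rightarrow> 'g set \<Rightarrow> 'x \<Rightarrow> bool" where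
  "dominates G \<phi> u S x \<longleftrightarrow> (\<forall>s \<in> S. \<forall>t \<in> carrier G - S. u (\<phi> t x) < u (\<phi> s x))"

definition top_set ::
    "('g, 'b) monoid_scheme \<Rightarrow> 'x topology \<Rightarrow> ('g \<Rightarrow> 'x \<Rightarrow> 'x) \<Rightarrow> ('x \<Rightarrow> real) \<Rightarrow> nat \<Rightarrow> 'x set" where
  "top_set G X \<phi> u j =
     {x \<in> topspace X. \<exists>S \<subseteq> carrier G. card S = j \<and> dominates G \<phi> u S x}"

text \<open>Dominating sets of the same point are linearly ordered by inclusion, so their size determines them.\<close>

lemma dominates_unique:
  assumes "finite (carrier G)" and "S \<subseteq> carrier G" "T \<subseteq> carrier G" "card S = card T"
    and "dominates G \<phi> u S x" "dominates G \<phi> u T x"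
  shows "S = T"
proof (rule ccontr)
  assume ne: "S \<noteq> T"
  have "finite S" "finite T"
    using assms finite_subset by blast+
  then have "\<not> S \<subseteq> T" "\<not> T \<subseteq> S"
    using ne assms(4) by (metis card_subset_eq)+
  then obtain s t where "s \<in> S - T" "t \<in> T - S"
    by blast
  then have "u (\<phi> t x) < u (\<phi> s x)" "u (\<phi> s x) < u (\<phi> t x)"
    using assms unfolding dominates_def by blast+
  then show False
    by simp
qed

text \<open>
  On \<open>top_set\<close> the dominating set of size \<open>j\<close> is unique and locally constant. If \<open>S\<close> dominates at \<open>x\<close>,
  then \<open>S g\<^sup>-\<^sup>1\<close> dominates at \<open>g x\<close>, because \<open>(s g\<^sup>-\<^sup>1) (g x) = s x\<close>. The equivariant selection applied to
  this set is the map to \<open>G\<close>.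
\<close>

lemma tube_top_set:
  assumes G: "G_space G X \<phi>" and com: "comm_group G" and fin: "finite (carrier G)"
    and cop: "coprime j (Coset.order G)"
    and u: "continuous_map X euclideanreal u"
  shows "tube G X \<phi> (top_set G X \<phi> u j)"
proof -
  interpret comm_group G
    by fact
  note act = G_space_closed[OF G] G_space_comp[OF G]
  obtain \<tau> where \<tau>: "\<And>S. S \<subseteq> carrier G \<Longrightarrow> card S = j \<Longrightarrow> \<tau> S \<in> carrier G"
      "\<And>S g. S \<subseteq> carrier G \<Longrightarrow> card S = j \<Longrightarrow> g \<in> carrier G \<Longrightarrow>
           \<tau> ((\<lambda>s. s \<otimes>\<^bsub>G\<^esub> inv\<^bsub>G\<^esub> g) ` S) = g \<otimes>\<^bsub>G\<^esub> \<tau> S"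
    using equivariant_selection[OF fin cop] by blast
  define top where "top S x \<longleftrightarrow> S \<subseteq> carrier G \<and> card S = j \<and> dominates G \<phi> u S x" for S x
  define h where "h x = \<tau> (THE S. top S x)" for x
  have the: "(THE S. top S x) = S" if "top S x" for S x
    using that dominates_unique[OF fin, of _ S \<phi> u x] unfolding top_def by (intro the_equality) auto
  have h_eq: "h x = \<tau> S" if "top S x" for S x
    using the[OF that] by (simp add: h_def)
  let ?V = "top_set G X \<phi> u j"
  have V: "?V = {x \<in> topspace X. \<exists>S. top S x}"
    by (auto simp: top_set_def top_def)
  have op: "openin X {x \<in> topspace X. dominates G \<phi> u S x}" if S: "S \<subseteq> carrier G" for S
  proof -
    have cont: "continuous_map X euclideanreal (\<lambda>x. u (\<phi> g x))" if "g \<in> carrier G" for g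
      using continuous_map_compose[OF G_space_continuous[OF G that] u] by (simp add: o_def)
    have less: "openin X {x \<in> topspace X. u (\<phi> t x) < u (\<phi> s x)}"
      if "s \<in> carrier G" "t \<in> carrier G" for s t
    proof -
      have "continuous_map X euclideanreal (\<lambda>x. u (\<phi> s x) - u (\<phi> t x))"
        using that by (intro continuous_map_diff cont)
      from openin_continuous_map_preimage[OF this, of "{0<..}"] show ?thesis
        by simp
    qed
    let ?P = "S \<times> (carrier G - S)"
    have "{x \<in> topspace X. dominates G \<phi> u S x} =
        (\<Inter>(s, t) \<in> ?P. {x \<in> topspace X. u (\<phi> t x) < u (\<phi> s x)}) \<inter> topspace X"
      by (auto simp: dominates_def)
    also have "openin X \<dots>"
    proof (rule openin_INT)
      show "finite ?P"
        using S fin finite_subset by blast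
      show "openin X (case st of (s, t) \<Rightarrow> {x \<in> topspace X. u (\<phi> t x) < u (\<phi> s x)})"
        if "st \<in> ?P" for st
        using that S less by auto
    qed
    finally show ?thesis .
  qed
  have shift: "top ((\<lambda>s. s \<otimes>\<^bsub>G\<^esub> inv\<^bsub>G\<^esub> g) ` S) (\<phi> g x)"
    if S: "top S x" and g: "g \<in> carrier G" and x: "x \<in> topspace X" for S g x
  proof -
    have S': "S \<subseteq> carrier G" "card S = j" "dominates G \<phi> u S x"
      using S by (auto simp: top_def)
    have "inj_on (\<lambda>s. s \<otimes>\<^bsub>G\<^esub> inv\<^bsub>G\<^esub> g) S"
      using S' g by (intro inj_onI) (metis inv_closed right_cancel subsetD)
    moreover have "u (\<phi> t (\<phi> g x)) < u (\<phi> (s \<otimes>\<^bsub>G\<^esub> inv\<^bsub>G\<^esub> g) (\<phi> g x))"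
      if "s \<in> S" "t \<in> carrier G" "t \<notin> (\<lambda>s. s \<otimes>\<^bsub>G\<^esub> inv\<^bsub>G\<^esub> g) ` S" for s t
    proof -
      have s: "s \<in> carrier G"
        using that S' by blast
      have "t = (t \<otimes>\<^bsub>G\<^esub> g) \<otimes>\<^bsub>G\<^esub> inv\<^bsub>G\<^esub> g"
        using that g by (simp add: m_assoc)
      then have "t \<otimes>\<^bsub>G\<^esub> g \<in> carrier G - S"
        using that g by blast
      then have "u (\<phi> (t \<otimes>\<^bsub>G\<^esub> g) x) < u (\<phi> s x)"
        using S'(3) that by (auto simp: dominates_def)
      then show ?thesis
        using that s g x by (simp add: act m_assoc)
    qed
    ultimately show ?thesis
      using S' g unfolding top_def dominates_def by (auto simp: card_image)
  qed
  show ?thesis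
    unfolding tube_def
  proof (intro conjI exI[of _ h] ballI)
    have "?V = (\<Union>S \<in> {S. S \<subseteq> carrier G \<and> card S = j}. {x \<in> topspace X. dominates G \<phi> u S x})"
      by (auto simp: top_set_def)
    also have "openin X \<dots>"
      using op by blast
    finally show "openin X ?V" .
    show "G_invariant G \<phi> ?V"
      unfolding G_invariant_def V using shift act(1) by blast
    show "h \<in> ?V \<rightarrow> carrier G"
      unfolding V using h_eq \<tau>(1) by (auto simp: top_def)
    show "openin X {x \<in> ?V. h x = c}" if "c \<in> carrier G" for c
    proof -
      have "{x \<in> ?V. h x = c} =
          (\<Union>S \<in> {S. S \<subseteq> carrier G \<and> card S = j \<and> \<tau> S = c}. {x \<in> topspace X. dominates G \<phi> u S x})"
        unfolding V using h_eq by (auto simp: top_def)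
      then show ?thesis
        using op by auto
    qed
    show "h (\<phi> g x) = g \<otimes>\<^bsub>G\<^esub> h x" if "g \<in> carrier G" "x \<in> ?V" for g x
    proof -
      obtain S where "top S x" "x \<in> topspace X"
        using \<open>x \<in> ?V\<close> unfolding V by blast
      then show ?thesis
        using h_eq h_eq[OF shift] \<tau>(2) that by (simp add: top_def)
    qed
  qed
qed

lemma mem_top_set_argmax:
  assumes "finite (carrier G)" and "carrier G \<noteq> {}" and "x \<in> topspace X"
  obtains S where "S \<subseteq> carrier G" and "S \<noteq> {}" and "x \<in> top_set G X \<phi> u (card S)"
    and "\<And>s t. s \<in> S \<Longrightarrow> t \<in> S \<Longrightarrow> u (\<phi> s x) = u (\<phi> t x)"
proof -
  define M where "M = Max ((\<lambda>g. u (\<phi> g x)) ` carrier G)"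
  define S where "S = {g \<in> carrier G. u (\<phi> g x) = M}"
  have "M \<in> (\<lambda>g. u (\<phi> g x)) ` carrier G"
    unfolding M_def using assms by (intro Max_in) auto
  then have "S \<subseteq> carrier G" "S \<noteq> {}"
    by (auto simp: S_def)
  have "u (\<phi> g x) \<le> M" if "g \<in> carrier G" for g
    unfolding M_def using assms that by (intro Max_ge) auto
  then have "dominates G \<phi> u S x"
    by (fastforce simp: dominates_def S_def)
  then have "x \<in> top_set G X \<phi> u (card S)"
    unfolding top_set_def using assms(3) \<open>S \<subseteq> carrier G\<close> by blast
  then show thesis
  proof (rule that[OF \<open>S \<subseteq> carrier G\<close> \<open>S \<noteq> {}\<close>])
    show "\<And>s t. s \<in> S \<Longrightarrow> t \<in> S \<Longrightarrow> u (\<phi> s x) = u (\<phi> t x)"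
      by (simp add: S_def)
  qed
qed

section \<open>The coincidence set\<close>

text \<open>
  With the set \<open>T\<close> of coinciding group elements in place of an enumeration \<open>\<gamma>\<close>, the coincidence set
  is a finite union, and a set of maxima can be compared with \<open>T\<close> directly.
\<close>

lemma coincidence_set_eq:
  assumes "finite (carrier G)"
  shows "coincidence_set G X \<phi> f k =
    (\<Union>T \<in> {T. T \<subseteq> carrier G \<and> card T = k}.
       {x \<in> topspace X. \<forall>s \<in> T. \<forall>t \<in> T. f (\<phi> s x) = f (\<phi> t x)})"
    (is "?A = ?B")
proof (intro equalityI subsetI)
  fix x
  assume "x \<in> ?A"
  then obtain \<gamma> where x: "x \<in> topspace X" and \<gamma>: "\<gamma> \<in> {1..k} \<rightarrow> carrier G" "inj_on \<gamma> {1..k}"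
    and eq: "\<forall>i \<in> {1..k}. \<forall>j \<in> {1..k}. f (\<phi> (\<gamma> i) x) = f (\<phi> (\<gamma> j) x)"
    unfolding coincidence_set_def by blast
  then have "\<gamma> ` {1..k} \<subseteq> carrier G \<and> card (\<gamma> ` {1..k}) = k"
    by (auto simp: card_image)
  moreover have "\<forall>s \<in> \<gamma> ` {1..k}. \<forall>t \<in> \<gamma> ` {1..k}. f (\<phi> s x) = f (\<phi> t x)"
    using eq by blast
  ultimately show "x \<in> ?B"
    using x by blast
next
  fix x
  assume "x \<in> ?B"
  then obtain T where x: "x \<in> topspace X" and T: "T \<subseteq> carrier G" "card T = k"
    and eq: "\<forall>s \<in> T. \<forall>t \<in> T. f (\<phi> s x) = f (\<phi> t x)"
    by blast
  have "finite T"
    using T assms finite_subset by blast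
  then obtain \<gamma> where "bij_betw \<gamma> {1..k} T"
    using ex_bij_betw_nat_finite_1 T(2) by blast
  then have "inj_on \<gamma> {1..k}" "\<gamma> ` {1..k} = T"
    by (auto simp: bij_betw_def)
  then have "\<gamma> i \<in> T" if "i \<in> {1..k}" for i
    using that by blast
  then have "\<gamma> \<in> {1..k} \<rightarrow> carrier G"
      "\<forall>i \<in> {1..k}. \<forall>j \<in> {1..k}. f (\<phi> (\<gamma> i) x) = f (\<phi> (\<gamma> j) x)"
    using T eq by blast+
  then show "x \<in> ?A"
    unfolding coincidence_set_def using x \<open>inj_on \<gamma> {1..k}\<close> by blast
qed

lemma closedin_coincidence_set:
  assumes G: "G_space G X \<phi>" and fin: "finite (carrier G)"
    and f: "continuous_map X Y f" and Y: "Hausdorff_space Y"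
  shows "closedin X (coincidence_set G X \<phi> f k)"
proof -
  have cont: "continuous_map X Y (\<lambda>x. f (\<phi> g x))" if "g \<in> carrier G" for g
    using continuous_map_compose[OF G_space_continuous[OF G that] f] by (simp add: o_def)
  have "closedin X {x \<in> topspace X. \<forall>s \<in> T. \<forall>t \<in> T. f (\<phi> s x) = f (\<phi> t x)}"
    if T: "T \<subseteq> carrier G" for T
  proof -
    have "{x \<in> topspace X. \<forall>s \<in> T. \<forall>t \<in> T. f (\<phi> s x) = f (\<phi> t x)} =
        \<Inter>(insert (topspace X)
          ((\<lambda>(s, t). {x \<in> topspace X. f (\<phi> s x) = f (\<phi> t x)}) ` (T \<times> T)))"
      by auto
    also have "closedin X \<dots>"
      using T Y by (intro closedin_Inter) (auto intro!: closedin_continuous_maps_eq cont)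
    finally show ?thesis .
  qed
  moreover have "finite {T. T \<subseteq> carrier G \<and> card T = k}"
    using fin by simp
  ultimately show ?thesis
    unfolding coincidence_set_eq[OF fin] by (intro closedin_Union) auto
qed

text \<open>
  Sizes are taken from the set where a coordinate is maximal on the orbit. For \<open>c \<noteq> c0\<close> it is a proper
  subset as soon as the coordinate is not constant on the orbit. If all these coordinates are constant,
  then \<open>f\<close> itself is constant on the set where the coordinate \<open>c0\<close> is maximal, and \<open>k\<close> elements in
  it would put \<open>x\<close> into the coincidence set.
\<close>

lemma complement_coincidence_set_cover:
  fixes f :: "'x \<Rightarrow> real ^ 'm"
  assumes fin: "finite (carrier G)" and ne: "carrier G \<noteq> {}"
    and x: "x \<in> topspace X - coincidence_set G X \<phi> f k"
  shows "\<exists>(c, j) \<in> (- {c0}) \<times> {1..<Coset.order G} \<union> {c0} \<times> {1..<k}.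
           x \<in> top_set G X \<phi> (\<lambda>y. f y $ c) j"
proof (cases "\<exists>c \<in> - {c0}. \<exists>s \<in> carrier G. \<exists>t \<in> carrier G. f (\<phi> s x) $ c \<noteq> f (\<phi> t x) $ c")
  case True
  then obtain c s t where c: "c \<noteq> c0" and st: "s \<in> carrier G" "t \<in> carrier G"
    "f (\<phi> s x) $ c \<noteq> f (\<phi> t x) $ c"
    by blast
  obtain S where S: "S \<subseteq> carrier G" "S \<noteq> {}" "x \<in> top_set G X \<phi> (\<lambda>y. f y $ c) (card S)"
    and eq: "\<And>s t. s \<in> S \<Longrightarrow> t \<in> S \<Longrightarrow> f (\<phi> s x) $ c = f (\<phi> t x) $ c"
    using mem_top_set_argmax[OF fin ne, of x X \<phi> "\<lambda>y. f y $ c"] x by blast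
  have "S \<subset> carrier G"
    using S(1) eq st by blast
  then have "card S < Coset.order G"
    using fin by (simp add: Coset.order_def psubset_card_mono)
  moreover have "1 \<le> card S"
    using S fin by (metis One_nat_def Suc_leI card_gt_0_iff finite_subset)
  ultimately show ?thesis
    using c S(3) by (intro bexI[of _ "(c, card S)"]) auto
next
  case False
  obtain S where S: "S \<subseteq> carrier G" "S \<noteq> {}" "x \<in> top_set G X \<phi> (\<lambda>y. f y $ c0) (card S)"
    and eq: "\<And>s t. s \<in> S \<Longrightarrow> t \<in> S \<Longrightarrow> f (\<phi> s x) $ c0 = f (\<phi> t x) $ c0"
    using mem_top_set_argmax[OF fin ne, of x X \<phi> "\<lambda>y. f y $ c0"] x by blast
  have f_eq: "f (\<phi> s x) = f (\<phi> t x)" if "s \<in> S" "t \<in> S" for s t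
  proof (rule vec_eq_iff[THEN iffD2], rule allI)
    fix c
    show "f (\<phi> s x) $ c = f (\<phi> t x) $ c"
    proof (cases "c = c0")
      case True
      then show ?thesis
        using eq[OF that] by simp
    next
      assume "c \<noteq> c0"
      then show ?thesis
        using False S(1) that by blast
    qed
  qed
  have "card S < k"
  proof (rule ccontr)
    assume "\<not> card S < k"
    then obtain T where T: "T \<subseteq> S" "card T = k"
      by (meson linorder_not_less obtain_subset_with_card_n)
    then have "T \<subseteq> carrier G" "\<forall>s \<in> T. \<forall>t \<in> T. f (\<phi> s x) = f (\<phi> t x)"
      using S(1) T(1) f_eq by blast+
    then have "x \<in> coincidence_set G X \<phi> f k"
      using x T(2) by (auto simp: coincidence_set_eq[OF fin])
    then show False
      using x by blast
  qed
  moreover have "1 \<le> card S"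
    using S fin by (metis One_nat_def Suc_leI card_gt_0_iff finite_subset)
  ultimately show ?thesis
    using S(3) by (intro bexI[of _ "(c0, card S)"]) auto
qed

theorem corollary1p5:
  fixes G :: "('g, 'b) monoid_scheme"
    and X :: "'x topology"
    and \<phi> :: "'g \<Rightarrow> 'x \<Rightarrow> 'x"
    and f :: "'x \<Rightarrow> real ^ 'm"
    and p k :: nat
  assumes "prime p"
    and "group G" and "cyclic_group G" and "Coset.order G = p"
    and "2 \<le> k" and "k \<le> p"
    and "paracompact_space X" and "free_G_space G X \<phi>"
    and "free_genus G X \<phi> > enat ((CARD('m) - 1) * (p - 1) + k - 1)"
    and "continuous_map X euclidean f"
  shows "free_genus G (subtopology X (coincidence_set G X \<phi> f k)) \<phi>
           \<ge> free_genus G X \<phi> - enat ((CARD('m) - 1) * (p - 1)) - enat k + 1"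
proof -
  let ?A = "coincidence_set G X \<phi> f k"
  have G: "G_space G X \<phi>"
    using assms(8) by (simp add: free_G_space_def)
  have com: "comm_group G"
    using assms(2,3) by (simp add: group.cyclic_imp_abelian_group)
  have p: "card (carrier G) = p" "p > 0"
    using assms(1,4) by (auto simp: Coset.order_def prime_gt_0_nat)
  then have fin: "finite (carrier G)" and ne: "carrier G \<noteq> {}"
    using card_gt_0_iff by fastforce+
  obtain c0 :: 'm where True
    by blast
  let ?I = "(- {c0}) \<times> {1..<p} \<union> {c0} \<times> {1..<k}"
  let ?V = "\<lambda>(c, j). top_set G X \<phi> (\<lambda>y. f y $ c) j"
  have "free_genus G X \<phi> \<le> free_genus G (subtopology X ?A) \<phi> + enat (card ?I)"
  proof (rule free_genus_le_closed_add_card[OF G fin])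
    show "normal_space X"
      using assms(7) by (rule paracompact_imp_normal_space)
    show "closedin X ?A"
      using assms(10) by (rule closedin_coincidence_set[OF G fin]) simp
    show "G_invariant G \<phi> ?A"
      by (rule G_invariant_coincidence_set[OF G])
    show "finite ?I"
      by simp
    show "tube G X \<phi> (?V i)" if "i \<in> ?I" for i
    proof -
      obtain c j where i: "i = (c, j)"
        by (cases i)
      then have "0 < j" "j < p"
        using that assms(6) by auto
      then have "coprime j (Coset.order G)"
        using assms(1,4) by (metis coprime_commute nat_dvd_not_less prime_imp_coprime)
      moreover have "continuous_map X euclideanreal (\<lambda>y. f y $ c)"
        using continuous_map_compose[OF assms(10), of euclideanreal "\<lambda>v. v $ c"]
        by (simp add: o_def continuous_on_component)
      ultimately show ?thesis
        using tube_top_set[OF G com fin] by (simp add: i)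
    qed
    show "topspace X - ?A \<subseteq> (\<Union>i\<in>?I. ?V i)"
    proof
      fix x
      assume "x \<in> topspace X - ?A"
      from complement_coincidence_set_cover[OF fin ne this, of c0]
      show "x \<in> (\<Union>i\<in>?I. ?V i)"
        unfolding assms(4) by (metis (mono_tags, lifting) UN_I case_prod_unfold)
    qed
  qed
  moreover have "card ?I = (CARD('m) - 1) * (p - 1) + (k - 1)"
  proof -
    have "card ?I = card ((- {c0}) \<times> {1..<p}) + card ({c0} \<times> {1..<k})"
      by (intro card_Un_disjoint) auto
    also have "card (- {c0}) = CARD('m) - 1"
      by (simp add: Compl_eq_Diff_UNIV card_Diff_singleton)
    ultimately show ?thesis
      by (simp add: card_cartesian_product)
  qed
  ultimately have le: "free_genus G X \<phi> \<le> free_genus G (subtopology X ?A) \<phi>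
      + enat ((CARD('m) - 1) * (p - 1) + (k - 1))"
    by simp
  show ?thesis
  proof (cases "free_genus G (subtopology X ?A) \<phi>")
    case b: (enat b)
    then obtain n where n: "free_genus G X \<phi> = enat n"
      using le by (cases "free_genus G X \<phi>") auto
    show ?thesis
      using le assms(5,9) unfolding b n by (simp add: one_enat_def)
  qed simp
qed

end
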